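(* Let $T=\{x_1,\dots,x_k\}$ be a collection of $k$ distinct points of $\mathbb R^3\setminus\{\mathcal O\}$ that satisfies Hypothesis H1. Let $\gamma>0$ and $\epsilon'>0$ be real numbers with $\epsilon'\ge\epsilon_0+\gamma$, and let $\delta_\gamma=\frac1{\epsilon_0+\gamma}$. Let $g\in L^1(\mathbb S^2)$ be nonnegative with $g>0$ inside $D_T^{\delta_\gamma}$ and $g\equiv0$ outside $D_T^{\delta_\gamma}$. Let $f_1,\dots,f_k$ be positive real numbers such that $$\sum_{i=1}^k f_i=\mu_g(D_T^{\delta_\gamma}).$$ Let $\overline R=(\overline{\epsilon_1},\dots,\overline{\epsilon_k})$ and $\tilde R=(\tilde\epsilon_1,\dots,\tilde\epsilon_k)$ be refractors in $\mathcal R_{convex}^{\epsilon'}(T)$ such that $G_{convex}(\tilde R;\{x_i\})=G_{convex}(\overline R;\{x_i\})=f_i$ for all $i\in\{1,\dots,k\}$. Then the inequality $\tilde\epsilon_j\ge\overline{\epsilon_j}$ for some $j$ implies that $\tilde\epsilon_i\ge\overline{\epsilon_i}$ for all $i\in\{1,\dots,k\}$. Furthermore, the equality $\tilde\epsilon_j=\overline{\epsilon_j}$ for some $j$ implies that $\tilde\epsilon_i=\overline{\epsilon_i}$ for all $i\in\{1,\dots,k\}$.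
   Context: $\mathcal O$ is the origin of $\mathbb R^3$, $\mathbb S^2$ is the unit sphere centered at $\mathcal O$ with its standard measure $\sigma$, and $k_x=x/|x|$ for $x\ne\mathcal O$. For a target set $T$ put $c=\min_{x,y\in T}\langle k_x,k_y\rangle$, $\ell=\min_{x\in T}|x|$, $L=\max_{x\in T}|x|$. Hypothesis H1: $T$ is a compact subset of $\mathbb R^3$ contained in a half space of $\mathbb R^3$, $\ell>0$, and $2\ell c>L$. Under H1 define $$\epsilon_0=\frac{\ell+\sqrt{\ell^2-2L\ell c+L^2}}{2\ell c-L}.$$ Hyperboloids: for $x\in\mathbb R^3\setminus\{\mathcal O\}$ and $\epsilon>1$ let $D_\epsilon(x)=\{m\in\mathbb S^2:\langle m,k_x\rangle>1/\epsilon\}$, let $\mathrm h_{x,\epsilon}(m)=\frac{|x|(1-\epsilon^2)}{2\epsilon(1-\epsilon\langle m,k_x\rangle)}$ for $m\in D_\epsilon(x)$, and let $H_\epsilon(x)=\{m\,\mathrm h_{x,\epsilon}(m):m\in D_\epsilon(x)\}$. This is the branch, with $x$ as its focus, of the two-sheeted hyperboloid of revolution with foci $\mathcal O$ and $x$ and eccentricity $\epsilon$. $\tilde H_\epsilon(x)$ is the (closed) convex body bounded by $H_\epsilon(x)$. $H(x)$ denotes any such hyperboloid $H_\epsilon(x)$, $\epsilon>1$. Aperture: $A_x^\delta=\{m\in\mathbb S^2:\langle m,k_x\rangle\ge\delta\}$ and $D_T^{\delta_\gamma}=\mathrm{Int}\left(\bigcap_{x\in T}A_x^{\delta_\gamma}\right)$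 (interior in $\mathbb S^2$). Refractors: for $\epsilon'\ge\epsilon_0+\gamma$, $\mathcal R_{convex}^{\epsilon'}(T)$ is the set of all $R=\partial\left(\bigcap_{x\in T}\tilde H_{\epsilon_x}(x)\right)$ with each $\epsilon_x\ge\epsilon'$. For $T=\{x_1,\dots,x_k\}$, $(\epsilon_1,\dots,\epsilon_k)$ (all $\epsilon_i\ge\epsilon'$) denotes the refractor $\partial\left(\bigcap_{i=1}^k\tilde H_{\epsilon_i}(x_i)\right)$. $H(x)$ is supporting to a set $Q\subset\mathbb R^3$ at $z\in\partial Q$ if $\tilde H(x)\supseteq Q$ and $z\in H(x)\cap\partial Q$. For $R\in\mathcal R_{convex}^{\epsilon'}(T)$ and $\omega\subseteq T$ let $M(\omega)=\{z\in R:$ there is $x\in\omega$ and a hyperboloid $H(x)$ supporting to $R$ at $z\}$. The visibility set $V_{convex}(R;\omega)$ is the intersection of $\overline{D_T^{\delta_\gamma}}$ with the image of $M(\omega)$ under radial projection onto $\mathbb S^2$. For measurable $X\subseteq\mathbb S^2$, $\mu_g(X)=\int_X g\,d\sigma$; the energy function is $G_{convex}(R;\omega)=\mu_g(V_{convex}(R;\omega))$ for Borel $\omega\subseteq T$. *)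

theory Defs
  imports "HOL-Analysis.Analysis"
begin

text \<open>
  Throughout, \<open>\<R>\<^sup>3\<close> is \<^typ>\<open>real^3\<close>, the unit sphere is \<^term>\<open>sphere (0::real^3) 1\<close>, and
  the direction \<open>k\<^sub>x = x / |x|\<close> of a point \<open>x \<noteq> 0\<close> is \<^term>\<open>sgn (x::real^3)\<close>.
\<close>

abbreviation unit_sphere :: "(real^3) set" where
  "unit_sphere \<equiv> sphere 0 1"

text \<open>
  Surface measure on the unit sphere, as the cone measure: the area of \<open>A\<close> is three times the
  volume of the part of the open unit ball lying over \<open>A\<close>, so the total area is \<open>4 \<pi>\<close>.
  The completion makes all Lebesgue measurable functions on the sphere available.
\<close>

definition sphere_measure :: "(real^3) measure" where
  "sphere_measure =
     completion (scale_measure 3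
       (distr (restrict_space lborel (ball 0 1 - {0})) (restrict_space borel unit_sphere) sgn))"

lemma sgn_measurable_sphere:
  "sgn \<in> restrict_space lborel (ball 0 1 - {0}) \<rightarrow>\<^sub>M restrict_space borel unit_sphere"
proof (rule measurable_restrict_space2)
  show "sgn \<in> space (restrict_space lborel (ball 0 1 - {0})) \<rightarrow> unit_sphere"
    by (auto simp: space_restrict_space norm_sgn)
  have "(sgn :: real^3 \<Rightarrow> real^3) = (\<lambda>x. x /\<^sub>R norm x)" by (auto simp: sgn_div_norm)
  then have "(sgn :: real^3 \<Rightarrow> real^3) \<in> borel_measurable borel" by simp
  then show "(sgn :: real^3 \<Rightarrow> real^3) \<in> borel_measurable (restrict_space lborel (ball 0 1 - {0}))"
    by (simp add: measurable_restrict_space1)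
qed

lemma space_sphere_measure: "space sphere_measure = unit_sphere"
  by (simp add: sphere_measure_def space_completion space_scale_measure space_restrict_space)

lemma emeasure_sphere_measure: "emeasure sphere_measure unit_sphere = ennreal (4 * pi)"
proof -
  let ?N = "distr (restrict_space lborel (ball 0 1 - {0})) (restrict_space borel unit_sphere) sgn"
  have U: "unit_sphere \<in> sets (restrict_space borel unit_sphere)" by (simp add: sets_restrict_space_iff)
  have "emeasure ?N unit_sphere = emeasure (restrict_space lborel (ball 0 1 - {0::real^3})) (ball 0 1 - {0})"
    using sgn_measurable_sphere U
    by (subst emeasure_distr) (auto simp: space_restrict_space norm_sgn intro!: arg_cong2[where f=emeasure])
  also have "\<dots> = emeasure lborel (ball 0 1 - {0::real^3})"
    by (subst emeasure_restrict_space) auto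
  also have "\<dots> = emeasure lborel (ball 0 1 :: (real^3) set)"
    by (rule emeasure_Diff_null_set) auto
  also have "\<dots> = ennreal (unit_ball_vol 3)" by (simp add: emeasure_ball)
  also have "unit_ball_vol 3 = 4 / 3 * pi" using unit_ball_vol_odd[of 1] by (simp add: fact_numeral eval_nat_numeral)
  finally have "emeasure ?N unit_sphere = ennreal (4/3 * pi)" .
  then have "emeasure (scale_measure 3 ?N) unit_sphere = ennreal (4 * pi)"
    by (simp add: ennreal_mult'[symmetric] flip: ennreal_numeral)
  moreover have "unit_sphere \<in> sets (scale_measure 3 ?N)" using U by simp
  ultimately show ?thesis unfolding sphere_measure_def by (simp add: emeasure_completion)
qed

text \<open>
  The constants \<open>c\<close>, \<open>\<ell>\<close>, \<open>L\<close>. The infima and suprema are attained whenever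
  \<open>T\<close> is compact, nonempty and does not contain the origin.
\<close>

definition min_cos :: "(real^3) set \<Rightarrow> real" where
  "min_cos T = (INF p\<in>T \<times> T. sgn (fst p) \<bullet> sgn (snd p))"

definition min_norm :: "(real^3) set \<Rightarrow> real" where
  "min_norm T = (INF x\<in>T. norm x)"

definition max_norm :: "(real^3) set \<Rightarrow> real" where
  "max_norm T = (SUP x\<in>T. norm x)"

text \<open>
  The half space need not have the origin on its boundary. Nonemptiness of \<open>T\<close> is implicit in
  the use of minima and maxima over \<open>T\<close>.
\<close>

definition hypothesis_H1 :: "(real^3) set \<Rightarrow> bool" where
  "hypothesis_H1 T \<longleftrightarrow>
     T \<noteq> {} \<and> compact T \<and>
     (\<exists>a b. a \<noteq> 0 \<and> T \<subseteq> {y. a \<bullet> y \<le> b}) \<and>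
     min_norm T > 0 \<and>
     2 * min_norm T * min_cos T > max_norm T"

definition eps0 :: "(real^3) set \<Rightarrow> real" where
  "eps0 T =
     (min_norm T + sqrt ((min_norm T)\<^sup>2 - 2 * max_norm T * min_norm T * min_cos T + (max_norm T)\<^sup>2))
     / (2 * min_norm T * min_cos T - max_norm T)"

definition hyp_dom :: "real \<Rightarrow> real^3 \<Rightarrow> (real^3) set" where
  "hyp_dom \<epsilon> x = {m \<in> unit_sphere. m \<bullet> sgn x > 1 / \<epsilon>}"

definition hyp_radius :: "real^3 \<Rightarrow> real \<Rightarrow> real^3 \<Rightarrow> real" where
  "hyp_radius x \<epsilon> m = norm x * (1 - \<epsilon>\<^sup>2) / (2 * \<epsilon> * (1 - \<epsilon> * (m \<bullet> sgn x)))"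

definition hyperboloid :: "real \<Rightarrow> real^3 \<Rightarrow> (real^3) set" where
  "hyperboloid \<epsilon> x = (\<lambda>m. hyp_radius x \<epsilon> m *\<^sub>R m) ` hyp_dom \<epsilon> x"

text \<open>
  The closed convex body bounded by the hyperboloid. It is well defined for \<open>x \<noteq> 0\<close> and
  \<open>\<epsilon> > 1\<close>: see \<open>hyp_body_ex1\<close> and the explicit form \<open>hyp_body_eq\<close> below.
\<close>

definition hyp_body :: "real \<Rightarrow> real^3 \<Rightarrow> (real^3) set" where
  "hyp_body \<epsilon> x = (THE K. closed K \<and> convex K \<and> frontier K = hyperboloid \<epsilon> x)"

lemma hyperboloid_eq:
  assumes "x \<noteq> 0" "\<epsilon> > 1"
  shows "hyperboloid \<epsilon> x =
           {y. \<epsilon> * (y \<bullet> sgn x) - norm y = norm x * (\<epsilon>\<^sup>2 - 1) / (2 * \<epsilon>)}"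
proof -
  define a where "a = norm x * (\<epsilon>\<^sup>2 - 1) / (2 * \<epsilon>)"
  have "\<epsilon>\<^sup>2 > 1" using assms by (simp add: one_less_power)
  then have a: "a > 0" using assms by (simp add: a_def)
  have rad: "hyp_radius x \<epsilon> m = a / (\<epsilon> * (m \<bullet> sgn x) - 1)" for m
  proof -
    have "hyp_radius x \<epsilon> m =
        (- (norm x * (\<epsilon>\<^sup>2 - 1))) / (- (2 * \<epsilon> * (\<epsilon> * (m \<bullet> sgn x) - 1)))"
      unfolding hyp_radius_def by (simp add: algebra_simps)
    also have "\<dots> = a / (\<epsilon> * (m \<bullet> sgn x) - 1)"
      using assms by (simp only: a_def minus_divide_left[symmetric] minus_divide_right[symmetric] minus_minus divide_divide_eq_left)
    finally show ?thesis .
  qed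
  have dom: "m \<in> hyp_dom \<epsilon> x \<longleftrightarrow> norm m = 1 \<and> \<epsilon> * (m \<bullet> sgn x) > 1" for m
    using assms by (auto simp: hyp_dom_def field_simps)
  show ?thesis unfolding a_def[symmetric]
  proof (intro set_eqI iffI)
    fix y assume "y \<in> hyperboloid \<epsilon> x"
    then obtain m where m: "norm m = 1" "\<epsilon> * (m \<bullet> sgn x) > 1"
        "y = (a / (\<epsilon> * (m \<bullet> sgn x) - 1)) *\<^sub>R m"
      by (auto simp: hyperboloid_def dom rad)
    define t where "t = a / (\<epsilon> * (m \<bullet> sgn x) - 1)"
    have t: "t > 0" using a m by (simp add: t_def)
    have "\<epsilon> * (y \<bullet> sgn x) - norm y = t * (\<epsilon> * (m \<bullet> sgn x) - 1)"
      using m(1) t unfolding m(3) t_def[symmetric] by (simp add: algebra_simps)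
    also have "\<dots> = a" using m by (simp add: t_def)
    finally show "y \<in> {y. \<epsilon> * (y \<bullet> sgn x) - norm y = a}" by simp
  next
    fix y assume "y \<in> {y. \<epsilon> * (y \<bullet> sgn x) - norm y = a}"
    then have y: "\<epsilon> * (y \<bullet> sgn x) - norm y = a" by simp
    then have y0: "y \<noteq> 0" using a by auto
    define m where "m = sgn y"
    have ym: "y = norm y *\<^sub>R m" using y0 by (simp add: m_def sgn_div_norm)
    have m1: "norm m = 1" using y0 by (simp add: m_def norm_sgn)
    have "y \<bullet> sgn x = norm y * (m \<bullet> sgn x)" by (subst ym) simp
    then have *: "norm y * (\<epsilon> * (m \<bullet> sgn x) - 1) = a"
      using y by (simp add: algebra_simps)
    then have pos: "\<epsilon> * (m \<bullet> sgn x) - 1 > 0"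
      using a by (smt (verit) norm_ge_zero mult_nonneg_nonpos)
    then have "norm y = a / (\<epsilon> * (m \<bullet> sgn x) - 1)"
      using * by (simp add: field_simps)
    then have "y = hyp_radius x \<epsilon> m *\<^sub>R m" using ym rad by metis
    moreover have "m \<in> hyp_dom \<epsilon> x" using dom m1 pos by auto
    ultimately show "y \<in> hyperboloid \<epsilon> x" unfolding hyperboloid_def by blast
  qed
qed

lemma hyp_body_aux:
  assumes "x \<noteq> 0" "\<epsilon> > 1"
  defines "S \<equiv> {y. \<epsilon> * (y \<bullet> sgn x) - norm y \<ge> norm x * (\<epsilon>\<^sup>2 - 1) / (2 * \<epsilon>)}"
  shows "closed S" "convex S" "frontier S = hyperboloid \<epsilon> x" "interior S \<noteq> {}"
    "interior S = {y. \<epsilon> * (y \<bullet> sgn x) - norm y > norm x * (\<epsilon>\<^sup>2 - 1) / (2 * \<epsilon>)}"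
proof -
  define a where "a = norm x * (\<epsilon>\<^sup>2 - 1) / (2 * \<epsilon>)"
  define F where "F y = \<epsilon> * (y \<bullet> sgn x) - norm y" for y :: "real^3"
  have "\<epsilon>\<^sup>2 > 1" using assms by (simp add: one_less_power)
  then have a: "a > 0" using assms by (simp add: a_def)
  have S: "S = {y. a \<le> F y}" by (simp add: S_def a_def F_def)
  have contF: "continuous_on UNIV F" unfolding F_def by (intro continuous_intros)
  have scale: "F (t *\<^sub>R y) = t * F y" if "t \<ge> 0" for t y
    using that by (simp add: F_def algebra_simps)
  show cl: "closed S" unfolding S by (intro closed_Collect_le continuous_on_const contF)
  show "convex S"
  proof (rule convexI)
    fix y z and u v :: real
    assume yz: "y \<in> S" "z \<in> S" and uv: "u \<ge> 0" "v \<ge> 0" "u + v = 1"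
    have "norm (u *\<^sub>R y + v *\<^sub>R z) \<le> u * norm y + v * norm z"
      using norm_triangle_ineq[of "u *\<^sub>R y" "v *\<^sub>R z"] uv by simp
    then have "F (u *\<^sub>R y + v *\<^sub>R z) \<ge> u * F y + v * F z"
      by (simp add: F_def algebra_simps)
    moreover have "u * F y + v * F z \<ge> u * a + v * a"
      using yz uv by (intro add_mono mult_left_mono) (auto simp: S)
    moreover have "u * a + v * a = a" using uv by (metis distrib_right mult_1)
    ultimately show "u *\<^sub>R y + v *\<^sub>R z \<in> S" by (simp add: S)
  qed
  have op: "open {y. a < F y}" by (intro open_Collect_less continuous_on_const contF)
  have int: "interior S = {y. a < F y}"
  proof
    show "{y. a < F y} \<subseteq> interior S" by (rule interior_maximal) (auto simp: S op)
    show "interior S \<subseteq> {y. a < F y}"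
    proof
      fix y assume y: "y \<in> interior S"
      then obtain e where e: "e > 0" "ball y e \<subseteq> S" by (auto simp: mem_interior)
      have Fy: "F y \<ge> a" using y interior_subset S by blast
      then have y0: "norm y > 0" using a by (auto simp: F_def)
      define t where "t = 1 - min (1/2) (e / (2 * norm y))"
      have t: "0 < t" "t < 1" using e y0 by (auto simp: t_def min_def field_simps)
      have "dist y (t *\<^sub>R y) = (1 - t) * norm y"
      proof -
        have "y - t *\<^sub>R y = (1 - t) *\<^sub>R y" by (simp add: algebra_simps)
        then show ?thesis using t by (simp add: dist_norm)
      qed
      also have "\<dots> \<le> e / (2 * norm y) * norm y"
        using y0 by (intro mult_right_mono) (auto simp: t_def)
      also have "\<dots> < e" using e y0 by simp
      finally have "t *\<^sub>R y \<in> S" using e by auto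
      then have "a \<le> t * F y" using t by (simp add: S scale)
      also have "\<dots> < F y" using t Fy a by simp
      finally show "y \<in> {y. a < F y}" by simp
    qed
  qed
  show "frontier S = hyperboloid \<epsilon> x"
    unfolding hyperboloid_eq[OF assms(1,2)] frontier_def closure_closed[OF cl] int
    unfolding a_def[symmetric] S F_def by auto
  have "F x > a"
  proof -
    have "x \<bullet> sgn x = norm x"
      using assms(1) by (simp add: sgn_div_norm dot_square_norm power2_eq_square)
    then have "F x = norm x * (\<epsilon> - 1)" by (simp add: F_def algebra_simps)
    also have "a = norm x * (\<epsilon> - 1) * ((\<epsilon> + 1) / (2 * \<epsilon>))"
      by (simp add: a_def power2_eq_square algebra_simps)
    then have "a < norm x * (\<epsilon> - 1)"
      using assms(1,2) mult_strict_left_mono[of "(\<epsilon> + 1) / (2 * \<epsilon>)" 1 "norm x * (\<epsilon> - 1)"]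
      by simp
    finally show ?thesis by simp
  qed
  then show "interior S \<noteq> {}" using int by auto
  show "interior S = {y. \<epsilon> * (y \<bullet> sgn x) - norm y > norm x * (\<epsilon>\<^sup>2 - 1) / (2 * \<epsilon>)}"
    using int by (simp add: F_def a_def)
qed

lemma hyp_body_unique:
  assumes "x \<noteq> 0" "\<epsilon> > 1"
    and K: "closed K" "convex K" "frontier K = hyperboloid \<epsilon> x"
  shows "K = {y. \<epsilon> * (y \<bullet> sgn x) - norm y \<ge> norm x * (\<epsilon>\<^sup>2 - 1) / (2 * \<epsilon>)}"
proof -
  define S where "S = {y. \<epsilon> * (y \<bullet> sgn x) - norm y \<ge> norm x * (\<epsilon>\<^sup>2 - 1) / (2 * \<epsilon>)}"
  note S = hyp_body_aux[OF assms(1,2), folded S_def]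
  have fr: "frontier K = frontier S" using K S by simp
  have step: "A \<subseteq> B" if "closed A" "convex A" "closed B" "convex B" "frontier A = frontier B"
    and ne: "interior A \<inter> interior B \<noteq> {}" for A B :: "(real^3) set"
  proof
    fix p assume p: "p \<in> A"
    obtain q where q: "q \<in> interior A" "q \<in> interior B" using ne by blast
    show "p \<in> B"
    proof (rule ccontr)
      assume pB: "p \<notin> B"
      have "closed_segment q p \<inter> frontier B \<noteq> {}"
        using q pB interior_subset
        by (intro connected_Int_frontier) auto
      then obtain w where w: "w \<in> closed_segment q p" "w \<in> frontier B" by blast
      have "w \<noteq> q" using w q by (auto simp: frontier_def)
      moreover have "w \<noteq> p" using w pB that(3) frontier_subset_closed by blast
      ultimately have "w \<in> open_segment q p" using w by (simp add: open_segment_def)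
      then have "w \<in> interior A"
        using in_interior_closure_convex_segment[OF that(2) q(1)] p closure_subset by blast
      then show False using w that(5) by (auto simp: frontier_def)
    qed
  qed
  define a where "a = norm x * (\<epsilon>\<^sup>2 - 1) / (2 * \<epsilon>)"
  have "\<epsilon>\<^sup>2 > 1" using assms by (simp add: one_less_power)
  then have a: "a > 0" using assms by (simp add: a_def)
  have frS: "frontier S = {y. \<epsilon> * (y \<bullet> sgn x) - norm y = a}"
    using S(3) hyperboloid_eq[OF assms(1,2)] by (simp add: a_def)
  have intS: "interior S = {y. \<epsilon> * (y \<bullet> sgn x) - norm y > a}"
    using S(5) by (simp add: a_def)
  \<comment> \<open>a chord of the hyperboloid through a point of its axis\<close>
  obtain e0 where e0: "e0 \<noteq> 0" "orthogonal x e0"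
    using orthogonal_to_vector_exists[of x] by auto
  define e where "e = sgn e0"
  define k where "k = sgn x"
  have ek: "norm e = 1" "norm k = 1" "k \<bullet> e = 0"
    using e0 assms(1) by (auto simp: e_def k_def norm_sgn sgn_div_norm orthogonal_def)
  define \<alpha> where "\<alpha> = 2 * a / (\<epsilon> - 1)"
  have "(\<epsilon> - 1) * \<alpha> = 2 * a" using assms(2) by (simp add: \<alpha>_def)
  then have \<alpha>: "\<alpha> > 0" "\<epsilon> * \<alpha> - \<alpha> = 2 * a"
    using a assms(2) by (simp add: \<alpha>_def, simp add: left_diff_distrib)
  define \<beta> where "\<beta> = sqrt ((\<epsilon> * \<alpha> - a)\<^sup>2 - \<alpha>\<^sup>2)"
  have "\<alpha>\<^sup>2 \<le> (\<epsilon> * \<alpha> - a)\<^sup>2" by (rule power_mono) (use \<alpha> a in linarith)+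
  then have \<beta>: "\<beta>\<^sup>2 = (\<epsilon> * \<alpha> - a)\<^sup>2 - \<alpha>\<^sup>2" by (simp add: \<beta>_def)
  have on: "\<alpha> *\<^sub>R k + b *\<^sub>R e \<in> frontier S" if "b\<^sup>2 = \<beta>\<^sup>2" for b
  proof -
    have kk: "k \<bullet> k = 1" "e \<bullet> e = 1" "e \<bullet> k = 0"
      using ek by (simp_all add: dot_square_norm inner_commute)
    have "(norm (\<alpha> *\<^sub>R k + b *\<^sub>R e))\<^sup>2 = \<alpha>\<^sup>2 + b\<^sup>2"
      unfolding power2_norm_eq_inner
      by (simp add: inner_add_left inner_add_right kk ek(3) power2_eq_square)
    also have "\<dots> = (\<epsilon> * \<alpha> - a)\<^sup>2" using that \<beta> by simp
    finally have sq: "(norm (\<alpha> *\<^sub>R k + b *\<^sub>R e))\<^sup>2 = (\<epsilon> * \<alpha> - a)\<^sup>2" .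
    have "\<epsilon> * \<alpha> - a \<ge> 0" using \<alpha> a by linarith
    with sq have "norm (\<alpha> *\<^sub>R k + b *\<^sub>R e) = \<epsilon> * \<alpha> - a"
      using power2_eq_imp_eq norm_ge_zero by blast
    then show ?thesis unfolding frS by (simp add: k_def[symmetric] inner_add_left kk)
  qed
  have "\<alpha> *\<^sub>R k \<in> K"
  proof -
    have "\<alpha> *\<^sub>R k + \<beta> *\<^sub>R e \<in> K" and "\<alpha> *\<^sub>R k + (- \<beta>) *\<^sub>R e \<in> K"
      using on[of \<beta>] on[of "- \<beta>"] fr frontier_subset_closed[OF K(1)] by auto
    then have "(1/2) *\<^sub>R (\<alpha> *\<^sub>R k + \<beta> *\<^sub>R e) + (1/2) *\<^sub>R (\<alpha> *\<^sub>R k + (- \<beta>) *\<^sub>R e) \<in> K"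
      by (rule convexD[OF K(2)]) simp_all
    moreover have "(1/2) *\<^sub>R (\<alpha> *\<^sub>R k + \<beta> *\<^sub>R e) + (1/2) *\<^sub>R (\<alpha> *\<^sub>R k + (- \<beta>) *\<^sub>R e) = \<alpha> *\<^sub>R k"
      by (simp add: vec_eq_iff field_simps)
    ultimately show ?thesis by simp
  qed
  moreover have mid: "\<alpha> *\<^sub>R k \<in> interior S"
  proof -
    have "k \<bullet> sgn x = 1" using ek by (simp add: k_def[symmetric] dot_square_norm)
    then have "\<epsilon> * ((\<alpha> *\<^sub>R k) \<bullet> sgn x) - norm (\<alpha> *\<^sub>R k) = \<epsilon> * \<alpha> - \<alpha>"
      using \<alpha>(1) ek by simp
    also have "\<dots> > a" using \<alpha>(2) a by linarith
    finally show ?thesis unfolding intS by simp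
  qed
  then have "\<alpha> *\<^sub>R k \<notin> frontier K" using fr by (auto simp: frontier_def)
  ultimately have "\<alpha> *\<^sub>R k \<in> interior K"
    using K(1) by (simp add: frontier_def closure_closed)
  with mid have "interior K \<inter> interior S \<noteq> {}" by blast
  then show ?thesis using step[OF K(1,2) S(1,2) fr] step[OF S(1,2) K(1,2)] fr S_def
    by (metis Int_commute subset_antisym)
qed

lemma hyp_body_ex1:
  assumes "x \<noteq> 0" "\<epsilon> > 1"
  shows "\<exists>!K. closed K \<and> convex K \<and> frontier K = hyperboloid \<epsilon> x"
  using hyp_body_aux[OF assms] hyp_body_unique[OF assms] by (intro ex1I) blast+

lemma hyp_body_eq:
  assumes "x \<noteq> 0" "\<epsilon> > 1"
  shows "hyp_body \<epsilon> x = {y. \<epsilon> * (y \<bullet> sgn x) - norm y \<ge> norm x * (\<epsilon>\<^sup>2 - 1) / (2 * \<epsilon>)}"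
  unfolding hyp_body_def
  using hyp_body_aux[OF assms] hyp_body_unique[OF assms] by (intro the_equality) blast+

text \<open>Apertures. Interiors are taken in the unit sphere.\<close>

definition aperture :: "real \<Rightarrow> real^3 \<Rightarrow> (real^3) set" where
  "aperture \<delta> x = {m \<in> unit_sphere. m \<bullet> sgn x \<ge> \<delta>}"

definition aperture_dom :: "(real^3) set \<Rightarrow> real \<Rightarrow> (real^3) set" where
  "aperture_dom T \<delta> = (top_of_set unit_sphere) interior_of (\<Inter>x\<in>T. aperture \<delta> x)"

definition convex_refractors :: "real \<Rightarrow> (real^3) set \<Rightarrow> (real^3) set set" where
  "convex_refractors \<epsilon>' T =
     {R. \<exists>\<epsilon>. (\<forall>x\<in>T. \<epsilon> x \<ge> \<epsilon>') \<and> R = frontier (\<Inter>x\<in>T. hyp_body (\<epsilon> x) x)}"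

text \<open>The refractor denoted by a tuple \<open>(\<epsilon>\<^sub>1, \<dots>, \<epsilon>\<^sub>k)\<close> of eccentricities.\<close>

definition refractor :: "nat \<Rightarrow> (nat \<Rightarrow> real^3) \<Rightarrow> (nat \<Rightarrow> real) \<Rightarrow> (real^3) set" where
  "refractor k x \<epsilon> = frontier (\<Inter>i\<in>{1..k}. hyp_body (\<epsilon> i) (x i))"

definition supporting :: "real \<Rightarrow> real^3 \<Rightarrow> (real^3) set \<Rightarrow> real^3 \<Rightarrow> bool" where
  "supporting \<epsilon> x Q z \<longleftrightarrow> Q \<subseteq> hyp_body \<epsilon> x \<and> z \<in> hyperboloid \<epsilon> x \<inter> frontier Q"

text \<open>
  The eccentricity of a hyperboloid supporting \<open>R\<close> is an arbitrary \<open>\<epsilon> > 1\<close>, not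
  necessarily one of those used to build \<open>R\<close>.
\<close>

definition contact_set :: "(real^3) set \<Rightarrow> (real^3) set \<Rightarrow> (real^3) set" where
  "contact_set R \<omega> = {z \<in> R. \<exists>x\<in>\<omega>. \<exists>\<epsilon>>1. supporting \<epsilon> x R z}"

definition visibility :: "(real^3) set \<Rightarrow> real \<Rightarrow> (real^3) set \<Rightarrow> (real^3) set \<Rightarrow> (real^3) set" where
  "visibility T \<delta> R \<omega> = closure (aperture_dom T \<delta>) \<inter> sgn ` contact_set R \<omega>"

definition energy_measure :: "(real^3 \<Rightarrow> real) \<Rightarrow> (real^3) set \<Rightarrow> real" where
  "energy_measure g X = (LINT m:X|sphere_measure. g m)"

definition energy ::
  "(real^3) set \<Rightarrow> real \<Rightarrow> (real^3 \<Rightarrow> real) \<Rightarrow> (real^3) set \<Rightarrow> (real^3) set \<Rightarrow> real" where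
  "energy T \<delta> g R \<omega> = energy_measure g (visibility T \<delta> R \<omega>)"

end

theory Submission
  imports Defs
begin

text \<open>
  Over a direction \<open>m\<close> of the aperture, the body bounded by \<open>H\<^sub>\<epsilon>(x)\<close> is the set of multiples
  \<open>t m\<close> with \<open>t\<close> at least the radius \<open>h\<^sub>x\<^sub>,\<^sub>\<epsilon>(m)\<close>, and this radius is strictly decreasing in the
  eccentricity. So a refractor is the graph of the largest of \<open>k\<close> radii, and the aperture
  \<open>D\<close> is covered by the relatively closed cells \<open>A\<^sub>i\<close> on which the \<open>i\<close>-th radius is the largest.

  Over \<open>A\<^sub>i\<close> the \<open>i\<close>-th hyperboloid itself supports the refractor, hence \<open>A\<^sub>i\<close> lies in the
  visibility set of \<open>x\<^sub>i\<close>. Visibility sets may a priori be larger, because any eccentricity is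
  allowed for a supporting hyperboloid. The energy balance excludes this up to null sets:
  \<open>\<mu>(D) \<le> \<Sum>\<mu>(A\<^sub>i) \<le> \<Sum>f\<^sub>i = \<mu>(D)\<close>. Therefore \<open>\<mu>(A\<^sub>i) = f\<^sub>i\<close>
  (\<open>energy_measure_cell\<close>), and since the same chain leaves no room for overlaps, the cells with
  index in \<open>J\<close> together have energy \<open>\<Sum>\<^sub>J f\<^sub>i\<close> (\<open>energy_measure_UN_eq_sum\<close>).

  Now compare two solutions, and let \<open>J\<close> be the set of indices whose eccentricity is smaller in
  the second one. Passing to the second solution raises the radii in \<open>J\<close> and raises no others.
  So a direction in a first cell with index in \<open>J\<close> is in no second cell with index outside
  \<open>J\<close>: the union \<open>W\<close> of the former and the union \<open>W'\<close> of the latter are disjoint. By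
  the above their energies add up to that of \<open>D\<close>. The rest of \<open>D\<close> is open and has energy
  zero, hence is empty, as \<open>g > 0\<close> on \<open>D\<close>. Thus \<open>D\<close>, which is connected, is the disjoint
  union of two relatively closed sets, and one of them is empty. As each cell has positive energy,
  \<open>J\<close> is empty or contains all indices (\<open>eccentricities_le\<close>). This is the first
  assertion, and the second one follows by symmetry.
\<close>

section \<open>The radial function of a hyperboloid\<close>

lemma inner_sgn_le_1:
  fixes m :: "real^3"
  assumes "norm m = 1"
  shows "m \<bullet> sgn x \<le> 1"
proof -
  have "m \<bullet> sgn x \<le> norm m * norm (sgn x)" by (rule norm_cauchy_schwarz)
  also have "\<dots> \<le> 1" using assms by (simp add: norm_sgn)
  finally show ?thesis .
qed

lemma hyp_radius_eq:
  assumes "\<epsilon> > 0"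
  shows "hyp_radius x \<epsilon> m = norm x * (\<epsilon>\<^sup>2 - 1) / (2 * \<epsilon>) / (\<epsilon> * (m \<bullet> sgn x) - 1)"
proof -
  have "hyp_radius x \<epsilon> m =
      (- (norm x * (\<epsilon>\<^sup>2 - 1))) / (- (2 * \<epsilon> * (\<epsilon> * (m \<bullet> sgn x) - 1)))"
    unfolding hyp_radius_def by (simp add: algebra_simps)
  then show ?thesis
    by (simp only: minus_divide_left[symmetric] minus_divide_right[symmetric] minus_minus
        divide_divide_eq_left)
qed

lemma hyp_radius_pos:
  assumes "x \<noteq> 0" "\<epsilon> > 1" "\<epsilon> * (m \<bullet> sgn x) > 1"
  shows "hyp_radius x \<epsilon> m > 0"
proof -
  have "\<epsilon>\<^sup>2 > 1" using assms by (simp add: one_less_power)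
  then show ?thesis using assms by (simp add: hyp_radius_eq)
qed

text \<open>
  Up to the factor \<open>|x| / 2\<close> the radius is \<open>(\<epsilon>\<^sup>2 - 1) / (\<epsilon> (\<epsilon> c - 1))\<close> with
  \<open>c = \<langle>m, k\<^sub>x\<rangle> \<le> 1\<close>. Over the positive common denominator, its value at \<open>e\<close> minus its
  value at \<open>s\<close> has the numerator
  \<open>(s - e) (1 + e s - c (e + s)) \<ge> (s - e) (e - 1) (s - 1) > 0\<close>.
\<close>

lemma hyp_radius_strict_antimono:
  assumes "x \<noteq> 0" "norm m = 1" "e > 1" "e < s" "e * (m \<bullet> sgn x) > 1"
  shows "hyp_radius x s m < hyp_radius x e m"
proof -
  define c where "c = m \<bullet> sgn x"
  have c: "c \<le> 1" "e * c > 1" using inner_sgn_le_1[OF assms(2)] assms(5) by (auto simp: c_def)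
  have "c > 0" using c(2) assms(3) by (smt (verit) mult_nonneg_nonpos)
  then have sc: "s * c > 1" using c(2) assms(4) mult_strict_right_mono[of e s c] by linarith
  have "c * (e + s) \<le> 1 * (e + s)" using c assms by (intro mult_right_mono) auto
  moreover have "(e - 1) * (s - 1) > 0" using assms by simp
  ultimately have "1 + e * s - c * (e + s) > 0" by (simp add: algebra_simps)
  then have "(s - e) * (1 + e * s - c * (e + s)) > 0" using assms by simp
  also have "(s - e) * (1 + e * s - c * (e + s)) =
      (e\<^sup>2 - 1) * (s * (s * c - 1)) - (s\<^sup>2 - 1) * (e * (e * c - 1))"
    by (simp add: algebra_simps power2_eq_square)
  finally have less: "(s\<^sup>2 - 1) * (e * (e * c - 1)) < (e\<^sup>2 - 1) * (s * (s * c - 1))" by simp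
  have "a / p < b / q" if "a * q < b * p" "p > 0" "q > 0" for a b p q :: real
    using that by (simp add: field_simps)
  from this[OF less] have "(s\<^sup>2 - 1) / (s * (s * c - 1)) < (e\<^sup>2 - 1) / (e * (e * c - 1))"
    using assms c sc by simp
  then have "norm x / 2 * ((s\<^sup>2 - 1) / (s * (s * c - 1))) <
      norm x / 2 * ((e\<^sup>2 - 1) / (e * (e * c - 1)))"
    using assms(1) by (intro mult_strict_left_mono) auto
  moreover have "hyp_radius x r m = norm x / 2 * ((r\<^sup>2 - 1) / (r * (r * c - 1)))" if "r > 1" for r
    using that by (simp add: hyp_radius_eq c_def)
  ultimately show ?thesis using assms by simp
qed

lemma hyp_radius_antimono:
  assumes "x \<noteq> 0" "norm m = 1" "e > 1" "e \<le> s" "e * (m \<bullet> sgn x) > 1"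
  shows "hyp_radius x s m \<le> hyp_radius x e m"
  using hyp_radius_strict_antimono[of x m e s] assms by (cases "e = s") auto

lemma scaleR_mem_hyp_body_iff:
  assumes "x \<noteq> 0" "\<epsilon> > 1" "norm m = 1" "\<epsilon> * (m \<bullet> sgn x) > 1" "r \<ge> 0"
  shows "r *\<^sub>R m \<in> hyp_body \<epsilon> x \<longleftrightarrow> hyp_radius x \<epsilon> m \<le> r"
proof -
  have "\<epsilon> * (r *\<^sub>R m \<bullet> sgn x) - norm (r *\<^sub>R m) = r * (\<epsilon> * (m \<bullet> sgn x) - 1)"
    using assms by (simp add: algebra_simps)
  then have "r *\<^sub>R m \<in> hyp_body \<epsilon> x \<longleftrightarrow>
      norm x * (\<epsilon>\<^sup>2 - 1) / (2 * \<epsilon>) \<le> r * (\<epsilon> * (m \<bullet> sgn x) - 1)"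
    by (simp add: hyp_body_eq[OF assms(1,2)])
  also have "\<dots> \<longleftrightarrow> norm x * (\<epsilon>\<^sup>2 - 1) / (2 * \<epsilon>) / (\<epsilon> * (m \<bullet> sgn x) - 1) \<le> r"
    using assms(4) by (subst pos_divide_le_eq) auto
  finally show ?thesis using assms by (simp add: hyp_radius_eq)
qed

section \<open>The aperture\<close>

text \<open>
  This makes all admissible eccentricities exceed 1, and it makes the aperture constant
  \<open>1 / (\<epsilon>\<^sub>0 + \<gamma>)\<close> smaller than 1. It holds because \<open>c \<le> 1\<close> and \<open>\<ell> \<le> L\<close>: the root is then
  at least \<open>L - \<ell>\<close>, so that the numerator is at least \<open>L\<close>, and the denominator is at most
  \<open>2 \<ell> - L \<le> L\<close>.
\<close>

lemma eps0_ge_1: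
  assumes "hypothesis_H1 T"
  shows "eps0 T \<ge> 1"
proof -
  define l L c where lLc: "l = min_norm T" "L = max_norm T" "c = min_cos T"
  have H: "T \<noteq> {}" "compact T" "l > 0" "2 * l * c > L"
    using assms by (auto simp: hypothesis_H1_def lLc)
  obtain x where x: "x \<in> T" using H by blast
  obtain B where B: "\<And>y. y \<in> T \<Longrightarrow> norm y \<le> B"
    using compact_imp_bounded[OF H(2)] bounded_iff by blast
  have "l \<le> norm x" unfolding lLc min_norm_def
    by (rule cINF_lower[OF _ x]) (auto intro!: bdd_belowI[of _ 0])
  moreover have "norm x \<le> L" unfolding lLc max_norm_def
    by (rule cSUP_upper[OF x]) (auto intro!: bdd_aboveI[of _ B] B)
  ultimately have lL: "l \<le> L" by simp
  have "- 1 \<le> sgn y \<bullet> sgn z" for y z :: "real^3"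
  proof -
    have "\<bar>sgn y \<bullet> sgn z\<bar> \<le> norm (sgn y) * norm (sgn z)" by (rule Cauchy_Schwarz_ineq2)
    also have "\<dots> \<le> 1" by (simp add: norm_sgn)
    finally show ?thesis by simp
  qed
  then have "c \<le> sgn (fst (x, x)) \<bullet> sgn (snd (x, x))" unfolding lLc min_cos_def
    using x by (intro cINF_lower) (auto intro!: bdd_belowI[of _ "-1"])
  then have "c \<le> (norm (sgn x))\<^sup>2" by (simp add: power2_norm_eq_inner)
  then have c: "c \<le> 1" by (simp add: norm_sgn split: if_splits)
  have "L * l * c \<le> L * l * 1" using c lL H by (intro mult_left_mono) auto
  then have "(L - l)\<^sup>2 \<le> l\<^sup>2 - 2 * L * l * c + L\<^sup>2"
    by (simp add: power2_eq_square algebra_simps)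
  then have "L - l \<le> sqrt (l\<^sup>2 - 2 * L * l * c + L\<^sup>2)" by (rule real_le_rsqrt)
  moreover have "l * c \<le> l * 1" using c H by (intro mult_left_mono) auto
  ultimately have "2 * l * c - L \<le> l + sqrt (l\<^sup>2 - 2 * L * l * c + L\<^sup>2)" using lL by simp
  then show ?thesis using H by (simp add: eps0_def lLc[symmetric])
qed

text \<open>
  A direction with \<open>\<langle>m, k\<^sub>x\<rangle> = \<delta>\<close> is not interior to the aperture of \<open>x\<close>: moving it slightly
  away from \<open>k\<^sub>x\<close> leaves the aperture.
\<close>

lemma aperture_dom_eq:
  assumes "finite T" "0 \<notin> T" "0 < \<delta>" "\<delta> < 1"
  shows "aperture_dom T \<delta> = {m \<in> unit_sphere. \<forall>x\<in>T. m \<bullet> sgn x > \<delta>}" (is "_ = ?D")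
  unfolding aperture_dom_def
proof (rule interior_of_unique)
  show "?D \<subseteq> (\<Inter>x\<in>T. aperture \<delta> x)" by (auto simp: aperture_def)
  have "open (\<Inter>x\<in>T. {m. m \<bullet> sgn x > \<delta>})"
    by (rule open_INT[OF assms(1)]) (intro ballI open_Collect_less continuous_on_const
        continuous_on_inner continuous_on_id)
  moreover have "?D = unit_sphere \<inter> (\<Inter>x\<in>T. {m. m \<bullet> sgn x > \<delta>})" by auto
  ultimately show "openin (top_of_set unit_sphere) ?D" by (simp only: openin_open_Int)
next
  fix U assume U: "U \<subseteq> (\<Inter>x\<in>T. aperture \<delta> x)" "openin (top_of_set unit_sphere) U"
  obtain Q where Q: "open Q" "U = unit_sphere \<inter> Q" using U(2) by (auto simp: openin_open)
  have "m \<bullet> sgn x > \<delta>" if mU: "m \<in> U" and xT: "x \<in> T" for m x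
  proof (rule ccontr)
    assume neg: "\<not> m \<bullet> sgn x > \<delta>"
    have x1: "norm (sgn x) = 1" using xT assms by (auto simp: norm_sgn)
    have m1: "norm m = 1" using mU Q by auto
    \<comment> \<open>\<open>\<langle>y t, k\<^sub>x\<rangle> \<le> \<delta> - t < \<delta> (1 - t) \<le> \<delta> |y t|\<close>, as \<open>\<delta> < 1\<close>\<close>
    define y where "y t = m - t *\<^sub>R sgn x" for t :: real
    have ny: "norm (y t) \<ge> 1 - t" if "t > 0" for t
      using norm_triangle_ineq2[of m "t *\<^sub>R sgn x"] that m1 x1 by (simp add: y_def)
    have "((\<lambda>t. sgn (y t)) \<longlongrightarrow> sgn (m - 0 *\<^sub>R sgn x)) (at_right 0)"
      unfolding y_def using m1 by (intro tendsto_intros) auto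
    then have "((\<lambda>t. sgn (y t)) \<longlongrightarrow> m) (at_right 0)" using m1 by (simp add: sgn_div_norm)
    then have "\<forall>\<^sub>F t in at_right 0. sgn (y t) \<in> Q"
      using Q mU by (auto dest: topological_tendstoD)
    moreover have "\<forall>\<^sub>F t in at_right (0::real). 0 < t \<and> t < 1"
      by (rule eventually_at_rightI[of 0 1]) auto
    ultimately have "\<forall>\<^sub>F t in at_right (0::real). sgn (y t) \<in> Q \<and> 0 < t \<and> t < 1"
      by eventually_elim auto
    then obtain t where t: "sgn (y t) \<in> Q" "0 < t" "t < 1"
      using eventually_happens[of _ "at_right (0::real)"] by (auto simp: trivial_limit_at_right_real)
    have y0: "norm (y t) > 0" using ny[OF t(2)] t(3) by linarith
    then have "sgn (y t) \<in> U" using Q t by (simp add: norm_sgn)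
    then have "sgn (y t) \<bullet> sgn x \<ge> \<delta>" using U(1) xT by (auto simp: aperture_def)
    then have "y t \<bullet> sgn x \<ge> \<delta> * norm (y t)"
      using y0 by (simp add: sgn_div_norm[of "y t"] field_simps)
    moreover have "\<delta> * norm (y t) \<ge> \<delta> * (1 - t)"
      using ny[OF t(2)] assms by (intro mult_left_mono) auto
    moreover have "y t \<bullet> sgn x = m \<bullet> sgn x - t"
      using x1 by (simp add: y_def inner_diff_left dot_square_norm)
    moreover have "\<delta> * t < t" using assms t by simp
    ultimately show False using neg by (simp add: algebra_simps)
  qed
  then show "U \<subseteq> ?D" using Q by auto
qed

text \<open>
  The aperture is the radial projection of the convex cone \<open>{y. \<forall>x\<in>T. \<langle>y, k\<^sub>x\<rangle> > \<delta> |y|}\<close>,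
  which misses the origin.
\<close>

lemma connected_cap_Inter:
  fixes T :: "(real^3) set"
  assumes "0 < \<delta>" "T \<noteq> {}"
  shows "connected {m \<in> unit_sphere. \<forall>x\<in>T. m \<bullet> sgn x > \<delta>}" (is "connected ?D")
proof -
  define C where "C = {y::real^3. \<forall>x\<in>T. y \<bullet> sgn x > \<delta> * norm y}"
  have "convex C"
  proof (rule convexI)
    fix y z and u v :: real
    assume yz: "y \<in> C" "z \<in> C" and uv: "u \<ge> 0" "v \<ge> 0" "u + v = 1"
    have n: "\<delta> * norm (u *\<^sub>R y + v *\<^sub>R z) \<le> \<delta> * (u * norm y + v * norm z)"
      using norm_triangle_ineq[of "u *\<^sub>R y" "v *\<^sub>R z"] uv assms by simp
    have "\<delta> * norm (u *\<^sub>R y + v *\<^sub>R z) < (u *\<^sub>R y + v *\<^sub>R z) \<bullet> sgn x" if "x \<in> T" for x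
    proof -
      have *: "\<delta> * norm y < y \<bullet> sgn x" "\<delta> * norm z < z \<bullet> sgn x"
        using yz that by (auto simp: C_def)
      have "u * (\<delta> * norm y) + v * (\<delta> * norm z) < u * (y \<bullet> sgn x) + v * (z \<bullet> sgn x)"
      proof (cases "u = 0")
        case True then show ?thesis using uv * by simp
      next
        case False
        then show ?thesis
          using uv * by (intro add_less_le_mono mult_strict_left_mono mult_left_mono) auto
      qed
      then show ?thesis using n by (simp add: inner_add_left algebra_simps)
    qed
    then show "u *\<^sub>R y + v *\<^sub>R z \<in> C" by (simp add: C_def)
  qed
  moreover have C0: "y \<noteq> 0" if "y \<in> C" for y using that assms by (auto simp: C_def)
  then have "continuous_on C (sgn :: real^3 \<Rightarrow> real^3)" by (intro continuous_intros) auto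
  ultimately have "connected (sgn ` C)" by (intro connected_continuous_image convex_connected)
  also have "sgn ` C = ?D"
  proof
    show "sgn ` C \<subseteq> ?D"
    proof
      fix m assume "m \<in> sgn ` C"
      then obtain y where y: "y \<in> C" "m = sgn y" by blast
      have "\<delta> < sgn y \<bullet> sgn x" if "x \<in> T" for x
      proof -
        have "y = norm y *\<^sub>R sgn y" using C0[OF y(1)] by (simp add: sgn_div_norm)
        then have "y \<bullet> sgn x = norm y * (sgn y \<bullet> sgn x)" by (metis inner_scaleR_left)
        moreover have "\<delta> * norm y < y \<bullet> sgn x" using y(1) that by (simp add: C_def)
        ultimately have "\<delta> * norm y < norm y * (sgn y \<bullet> sgn x)" by metis
        then show ?thesis using C0[OF y(1)]
          by (simp only: mult.commute[of \<delta>] mult_less_cancel_left_pos zero_less_norm_iff simp_thms)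
      qed
      then show "m \<in> ?D" using y C0 by (simp add: norm_sgn)
    qed
    show "?D \<subseteq> sgn ` C"
    proof
      fix m assume m: "m \<in> ?D"
      then have "m \<in> C" "sgn m = m" by (auto simp: C_def sgn_div_norm)
      then show "m \<in> sgn ` C" by (metis imageI)
    qed
  qed
  finally show ?thesis .
qed

section \<open>Cells and visibility sets\<close>

definition cell :: "(real^3) set \<Rightarrow> 'i set \<Rightarrow> ('i \<Rightarrow> real^3) \<Rightarrow> ('i \<Rightarrow> real) \<Rightarrow> 'i \<Rightarrow> (real^3) set" where
  "cell D I x e i = {m\<in>D. \<forall>j\<in>I. hyp_radius (x j) (e j) m \<le> hyp_radius (x i) (e i) m}"

lemma cell_subset: "cell D I x e i \<subseteq> D"
  by (auto simp: cell_def)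

lemma UN_cell_eq:
  assumes "finite I" "I \<noteq> {}"
  shows "(\<Union>i\<in>I. cell D I x e i) = D"
proof -
  have "\<exists>i\<in>I. m \<in> cell D I x e i" if "m \<in> D" for m
  proof -
    let ?h = "\<lambda>i. hyp_radius (x i) (e i) m"
    have "Max (?h ` I) \<in> ?h ` I" using assms by simp
    then obtain i where "i \<in> I" "?h i = Max (?h ` I)" by auto
    then show ?thesis using assms that by (force simp: cell_def)
  qed
  then show ?thesis by (auto simp: cell_def)
qed

lemma closedin_cell:
  assumes "i \<in> I" "\<And>j m. j \<in> I \<Longrightarrow> m \<in> D \<Longrightarrow> e j > 1 \<and> e j * (m \<bullet> sgn (x j)) > 1"
  shows "closedin (top_of_set D) (cell D I x e i)"
proof -
  have cont: "continuous_on D (hyp_radius (x j) (e j))" if "j \<in> I" for j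
    unfolding hyp_radius_def using assms(2)[OF that]
    by (force intro!: continuous_intros)
  have "closedin (top_of_set D)
      (D \<inter> (\<lambda>m. hyp_radius (x i) (e i) m - hyp_radius (x j) (e j) m) -` {0..})" if "j \<in> I" for j
    by (intro continuous_closedin_preimage continuous_on_diff cont that assms(1)) simp
  then have "closedin (top_of_set D) (\<Inter>j\<in>I.
      D \<inter> (\<lambda>m. hyp_radius (x i) (e i) m - hyp_radius (x j) (e j) m) -` {0..})"
    using assms(1) by (intro closedin_Inter) blast+
  also have "(\<Inter>j\<in>I. D \<inter> (\<lambda>m. hyp_radius (x i) (e i) m - hyp_radius (x j) (e j) m) -` {0..})
      = cell D I x e i"
    using assms(1) by (auto simp: cell_def)
  finally show ?thesis .
qed

lemma frontier_frontier_closed: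
  fixes K :: "'a::topological_space set"
  assumes "closed K"
  shows "frontier (frontier K) = frontier K"
proof -
  have "interior (frontier K) \<subseteq> interior K"
    using assms by (intro interior_mono) (rule frontier_subset_closed)
  moreover have "interior (frontier K) \<inter> interior K = {}"
    using interior_subset[of "frontier K"] by (auto simp: frontier_def)
  ultimately have "interior (frontier K) = {}" by blast
  then show ?thesis by (simp add: frontier_def[of "frontier K"] closure_closed)
qed

text \<open>
  Over the \<open>i\<close>-th cell the boundary point of the refractor lies on its \<open>i\<close>-th hyperboloid, whose
  body contains the whole refractor.
\<close>

lemma cell_subset_visibility:
  assumes i: "i \<in> {1..k}" and D: "D \<subseteq> aperture_dom T \<delta>"
    and dom: "\<And>j m. j \<in> {1..k} \<Longrightarrow> m \<in> D \<Longrightarrow>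
      norm m = 1 \<and> x j \<noteq> 0 \<and> e j > 1 \<and> e j * (m \<bullet> sgn (x j)) > 1"
  shows "cell D {1..k} x e i \<subseteq> visibility T \<delta> (refractor k x e) {x i}"
proof
  fix m assume m: "m \<in> cell D {1..k} x e i"
  then have mD: "m \<in> D" by (auto simp: cell_def)
  define K where "K = (\<Inter>j\<in>{1..k}. hyp_body (e j) (x j))"
  define r where "r = hyp_radius (x i) (e i) m"
  note dm = dom[OF _ mD]
  have r: "r > 0" unfolding r_def using dm[OF i] by (intro hyp_radius_pos) auto
  have body: "closed (hyp_body (e j) (x j))" "frontier (hyp_body (e j) (x j)) = hyperboloid (e j) (x j)"
    if "j \<in> {1..k}" for j
    using hyp_body_aux(1,3)[of "x j" "e j"] dm[OF that] by (simp_all add: hyp_body_eq)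
  have clK: "closed K" unfolding K_def using body by auto
  have R: "refractor k x e = frontier K" by (simp add: refractor_def K_def)
  have "m \<in> hyp_dom (e i) (x i)" using dm[OF i] by (simp add: hyp_dom_def field_simps)
  then have zH: "r *\<^sub>R m \<in> hyperboloid (e i) (x i)" by (auto simp: hyperboloid_def r_def)
  have "r *\<^sub>R m \<in> hyp_body (e j) (x j)" if "j \<in> {1..k}" for j
    using dm[OF that] r m that by (subst scaleR_mem_hyp_body_iff) (auto simp: cell_def r_def)
  then have "r *\<^sub>R m \<in> K" by (auto simp: K_def)
  moreover have "r *\<^sub>R m \<notin> interior K"
  proof
    assume "r *\<^sub>R m \<in> interior K"
    moreover have "interior K \<subseteq> interior (hyp_body (e i) (x i))"
      using i by (intro interior_mono) (auto simp: K_def)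
    ultimately show False using zH body(2)[OF i] by (auto simp: frontier_def)
  qed
  ultimately have zR: "r *\<^sub>R m \<in> frontier K" using clK by (simp add: frontier_def closure_closed)
  have "frontier K \<subseteq> hyp_body (e i) (x i)"
    using frontier_subset_closed[OF clK] i by (auto simp: K_def)
  then have "supporting (e i) (x i) (frontier K) (r *\<^sub>R m)"
    using zH zR by (simp add: supporting_def frontier_frontier_closed[OF clK])
  then have "r *\<^sub>R m \<in> contact_set (frontier K) {x i}"
    using zR dm[OF i] by (auto simp: contact_set_def)
  moreover have "sgn (r *\<^sub>R m) = m" using r dm[OF i] by (simp add: sgn_div_norm)
  ultimately have "m \<in> sgn ` contact_set (frontier K) {x i}" by (metis imageI)
  then show "m \<in> visibility T \<delta> (refractor k x e) {x i}"
    using mD D closure_subset[of "aperture_dom T \<delta>"] by (auto simp: visibility_def R)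
qed

section \<open>Energy\<close>

lemma sets_sphere_measure_openin:
  assumes "openin (top_of_set unit_sphere) E"
  shows "E \<in> sets sphere_measure"
proof -
  obtain Q where "open Q" "E = unit_sphere \<inter> Q" using assms by (auto simp: openin_open)
  then have "E \<in> sets (restrict_space borel unit_sphere)" by (auto simp: sets_restrict_space)
  then show ?thesis by (simp add: sphere_measure_def sets_completionI_sets)
qed

lemma sets_sphere_measure_closedin:
  assumes "openin (top_of_set unit_sphere) D" "closedin (top_of_set D) A"
  shows "A \<in> sets sphere_measure"
proof -
  have "openin (top_of_set D) (D - A)" "A \<subseteq> D"
    using assms(2) by (auto simp: closedin_def)
  then have "openin (top_of_set unit_sphere) (D - A)" "A = D - (D - A)"
    using assms(1) openin_trans by auto
  then show ?thesis using assms(1) sets_sphere_measure_openin by (metis sets.Diff)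
qed

lemma openin_sphere_null_imp_empty:
  assumes "openin (top_of_set unit_sphere) E" "E \<in> null_sets sphere_measure"
  shows "E = {}"
proof (rule ccontr)
  assume "E \<noteq> {}"
  obtain Q where Q: "open Q" "E = unit_sphere \<inter> Q" using assms by (auto simp: openin_open)
  let ?B = "ball 0 1 - {0::real^3}"
  let ?N = "distr (restrict_space lborel ?B) (restrict_space borel unit_sphere) sgn"
  have E: "E \<in> sets (restrict_space borel unit_sphere)"
    using Q by (auto simp: sets_restrict_space)
  have "emeasure (completion (scale_measure 3 ?N)) E = 0"
    using assms(2) by (auto simp: sphere_measure_def null_sets_def)
  then have "3 * emeasure ?N E = 0" using E by simp
  then have "emeasure ?N E = 0" by simp
  \<comment> \<open>the truncated cone over \<open>E\<close>, whose volume defines the measure of \<open>E\<close>\<close>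
  define P where "P = ?B \<inter> sgn -` Q"
  have "continuous_on ?B (sgn :: real^3 \<Rightarrow> real^3)" by (intro continuous_intros) auto
  then have oP: "open P" unfolding P_def using Q(1) by (intro continuous_open_preimage) auto
  have "sgn -` E \<inter> space (restrict_space lborel ?B) = P"
    using Q by (auto simp: P_def space_restrict_space norm_sgn)
  then have "emeasure (restrict_space lborel ?B) P = 0"
    using \<open>emeasure ?N E = 0\<close> E sgn_measurable_sphere by (simp add: emeasure_distr)
  then have "emeasure lborel P = 0"
    by (subst (asm) emeasure_restrict_space) (auto simp: P_def)
  then have "P \<in> null_sets lebesgue"
    using oP by (intro null_sets_completionI) auto
  then have "P = {}" using open_not_negligible[OF oP] negligible_iff_null_sets by blast
  moreover obtain m where m: "m \<in> E" using \<open>E \<noteq> {}\<close> by blast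
  then have "(1/2) *\<^sub>R m \<in> P" using Q by (auto simp: P_def sgn_div_norm)
  ultimately show False by blast
qed

lemma energy_measure_zero_openin_imp_empty:
  assumes "integrable sphere_measure g" "openin (top_of_set unit_sphere) E"
    and pos: "\<And>m. m \<in> E \<Longrightarrow> g m > 0" and zero: "energy_measure g E = 0"
  shows "E = {}"
proof (rule openin_sphere_null_imp_empty[OF assms(2)])
  have E: "E \<in> sets sphere_measure" using assms(2) by (rule sets_sphere_measure_openin)
  have int: "integrable sphere_measure (\<lambda>m. indicator E m *\<^sub>R g m)"
    using E assms(1) by (rule integrable_mult_indicator)
  have "AE m in sphere_measure. indicator E m *\<^sub>R g m = 0"
    using zero integral_nonneg_eq_0_iff_AE[OF int] pos
    by (auto simp: energy_measure_def set_lebesgue_integral_def indicator_def less_imp_le)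
  then have "AE m in sphere_measure. m \<notin> E"
    by eventually_elim (use pos in \<open>force simp: indicator_def\<close>)
  then show "E \<in> null_sets sphere_measure" using AE_iff_null_sets[OF E] by blast
qed

lemma energy_measure_mono:
  assumes "integrable sphere_measure g" "A \<in> sets sphere_measure" "B \<in> sets sphere_measure"
    "A \<subseteq> B" "\<And>m. m \<in> B \<Longrightarrow> g m \<ge> 0"
  shows "energy_measure g A \<le> energy_measure g B"
  unfolding energy_measure_def set_lebesgue_integral_def
  using assms by (intro integral_mono integrable_mult_indicator) (auto simp: indicator_def)

text \<open>
  A visibility set is not known to be measurable in advance. If it is not, the integral over it is
  taken to be zero, which a positive prescribed energy excludes.
\<close>

lemma energy_measure_mono_nonzero:
  assumes "integrable sphere_measure g" "A \<in> sets sphere_measure"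
    "A \<subseteq> B" "\<And>m. m \<in> unit_sphere \<Longrightarrow> g m \<ge> 0" "energy_measure g B \<noteq> 0"
  shows "energy_measure g A \<le> energy_measure g B"
proof -
  have "integrable sphere_measure (\<lambda>m. indicator B m *\<^sub>R g m)"
    using assms(5) not_integrable_integral_eq
    unfolding energy_measure_def set_lebesgue_integral_def by blast
  then show ?thesis
    unfolding energy_measure_def set_lebesgue_integral_def
    using assms(3,4) integrable_mult_indicator[OF assms(2,1)]
    by (intro integral_mono) (auto simp: indicator_def space_sphere_measure)
qed

lemma energy_measure_UN_le:
  assumes "integrable sphere_measure g" "finite I"
    and sets: "\<And>i. i \<in> I \<Longrightarrow> A i \<in> sets sphere_measure"
    and nn: "\<And>i m. i \<in> I \<Longrightarrow> m \<in> A i \<Longrightarrow> g m \<ge> 0"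
  shows "energy_measure g (\<Union>i\<in>I. A i) \<le> (\<Sum>i\<in>I. energy_measure g (A i))"
proof -
  have int: "integrable sphere_measure (\<lambda>m. indicator (A i) m *\<^sub>R g m)" if "i \<in> I" for i
    using sets[OF that] assms(1) by (rule integrable_mult_indicator)
  have "(\<Union>i\<in>I. A i) \<in> sets sphere_measure" using assms by auto
  moreover have "indicator (\<Union>i\<in>I. A i) m *\<^sub>R g m \<le> (\<Sum>i\<in>I. indicator (A i) m *\<^sub>R g m)" for m
  proof (cases "m \<in> (\<Union>i\<in>I. A i)")
    case True
    then obtain i where i: "i \<in> I" "m \<in> A i" by blast
    have "indicator (A i) m *\<^sub>R g m \<le> (\<Sum>i\<in>I. indicator (A i) m *\<^sub>R g m)"
      using i nn assms(2) by (intro member_le_sum) (auto simp: indicator_def)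
    then show ?thesis using i True by simp
  next
    case False
    then show ?thesis by simp
  qed
  ultimately have "energy_measure g (\<Union>i\<in>I. A i) \<le>
      (\<integral>m. (\<Sum>i\<in>I. indicator (A i) m *\<^sub>R g m) \<partial>sphere_measure)"
    unfolding energy_measure_def set_lebesgue_integral_def
    using assms int by (intro integral_mono integrable_mult_indicator Bochner_Integration.integrable_sum) auto
  also have "\<dots> = (\<Sum>i\<in>I. energy_measure g (A i))"
    unfolding energy_measure_def set_lebesgue_integral_def
    using int by (intro Bochner_Integration.integral_sum) auto
  finally show ?thesis .
qed

lemma energy_measure_Un_disjoint:
  assumes "integrable sphere_measure g" "A \<in> sets sphere_measure" "B \<in> sets sphere_measure"
    "A \<inter> B = {}"
  shows "energy_measure g (A \<union> B) = energy_measure g A + energy_measure g B"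
  unfolding energy_measure_def
  by (intro set_integral_Un assms(4))
    (unfold set_integrable_def, (intro integrable_mult_indicator assms)+)

text \<open>
  Subadditivity loses nothing over \<open>I\<close>. As the partial unions over \<open>J\<close> and over \<open>I - J\<close>
  together still cover \<open>D\<close>, it loses nothing over \<open>J\<close> either.
\<close>

lemma energy_measure_UN_eq_sum:
  assumes g: "integrable sphere_measure g" and "finite I" "J \<subseteq> I"
    and sets: "\<And>i. i \<in> I \<Longrightarrow> A i \<in> sets sphere_measure"
    and nn: "\<And>m. m \<in> D \<Longrightarrow> g m \<ge> 0"
    and cover: "(\<Union>i\<in>I. A i) = D"
    and total: "(\<Sum>i\<in>I. energy_measure g (A i)) = energy_measure g D"
  shows "energy_measure g (\<Union>i\<in>J. A i) = (\<Sum>i\<in>J. energy_measure g (A i))"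
proof -
  have fin: "finite J" "finite (I - J)" using assms by (auto intro: finite_subset)
  have le: "energy_measure g (\<Union>i\<in>S. A i) \<le> (\<Sum>i\<in>S. energy_measure g (A i))" if "S \<subseteq> I" for S
  proof (rule energy_measure_UN_le[OF g])
    show "finite S" using that assms(2) by (rule finite_subset)
    show "g m \<ge> 0" if "i \<in> S" "m \<in> A i" for i m
      using that \<open>S \<subseteq> I\<close> cover by (intro nn) blast
  qed (use that sets in blast)
  let ?P = "\<Union>i\<in>J. A i" and ?Q = "\<Union>i\<in>I - J. A i"
  have m: "?P \<in> sets sphere_measure" "?Q \<in> sets sphere_measure"
    using fin sets \<open>J \<subseteq> I\<close> by (auto intro!: sets.finite_UN)
  have "D = ?P \<union> (?Q - ?P)" using cover \<open>J \<subseteq> I\<close> by blast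
  then have "energy_measure g D = energy_measure g ?P + energy_measure g (?Q - ?P)"
    using energy_measure_Un_disjoint[OF g m(1), of "?Q - ?P"] m by auto
  also have "energy_measure g (?Q - ?P) \<le> energy_measure g ?Q"
    using g m nn cover by (intro energy_measure_mono) auto
  finally have "energy_measure g D \<le> energy_measure g ?P + energy_measure g ?Q" by simp
  moreover have "(\<Sum>i\<in>I. energy_measure g (A i)) =
      (\<Sum>i\<in>J. energy_measure g (A i)) + (\<Sum>i\<in>I - J. energy_measure g (A i))"
    using assms(2,3) by (metis add.commute sum.subset_diff)
  ultimately show ?thesis using le[of J] le[of "I - J"] total \<open>J \<subseteq> I\<close> by auto
qed

text \<open>
  Each cell has energy at most \<open>f\<^sub>i\<close>, as it is contained in the visibility set. The cells cover
  \<open>D\<close>, whose energy is \<open>\<Sum>f\<^sub>i\<close>, so none of these inequalities is strict. In this way the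
  hypotheses on visibility sets are replaced by hypotheses on cells.
\<close>

lemma energy_measure_cell:
  fixes f :: "nat \<Rightarrow> real"
  assumes g: "integrable sphere_measure g" and nn: "\<And>m. m \<in> unit_sphere \<Longrightarrow> g m \<ge> 0"
    and D: "D = aperture_dom T \<delta>" and k: "k > 0"
    and dom: "\<And>j m. j \<in> {1..k} \<Longrightarrow> m \<in> D \<Longrightarrow>
      norm m = 1 \<and> x j \<noteq> 0 \<and> e j > 1 \<and> e j * (m \<bullet> sgn (x j)) > 1"
    and en: "\<And>i. i \<in> {1..k} \<Longrightarrow> energy T \<delta> g (refractor k x e) {x i} = f i"
    and fpos: "\<And>i. i \<in> {1..k} \<Longrightarrow> f i > 0"
    and total: "(\<Sum>i\<in>{1..k}. f i) = energy_measure g D"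
    and i: "i \<in> {1..k}"
  shows "energy_measure g (cell D {1..k} x e i) = f i"
proof -
  let ?A = "cell D {1..k} x e"
  have oD: "openin (top_of_set unit_sphere) D" by (simp add: D aperture_dom_def)
  then have DS: "D \<subseteq> unit_sphere" by (auto simp: openin_open)
  have sets: "?A j \<in> sets sphere_measure" if "j \<in> {1..k}" for j
    using dom that by (intro sets_sphere_measure_closedin[OF oD] closedin_cell) auto
  have le: "energy_measure g (?A j) \<le> f j" if "j \<in> {1..k}" for j
  proof -
    have "?A j \<subseteq> visibility T \<delta> (refractor k x e) {x j}"
      by (rule cell_subset_visibility[OF that]) (use D dom in auto)
    then have "energy_measure g (?A j) \<le> energy_measure g (visibility T \<delta> (refractor k x e) {x j})"
      using en[OF that] fpos[OF that]
      by (intro energy_measure_mono_nonzero[OF g sets[OF that] _ nn]) (auto simp: energy_def)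
    then show ?thesis using en[OF that] by (simp add: energy_def)
  qed
  have "(\<Sum>j\<in>{1..k}. f j) = energy_measure g (\<Union>j\<in>{1..k}. ?A j)"
    using total UN_cell_eq[of "{1..k}" D x e] k by simp
  also have "\<dots> \<le> (\<Sum>j\<in>{1..k}. energy_measure g (?A j))"
  proof (rule energy_measure_UN_le[OF g])
    show "g m \<ge> 0" if "m \<in> ?A j" for j m
      using that subsetD[OF DS] by (intro nn) (simp add: cell_def)
  qed (simp, rule sets)
  finally have "(\<Sum>j\<in>{1..k}. f j) \<le> (\<Sum>j\<in>{1..k}. energy_measure g (?A j))" .
  then have "(\<Sum>j\<in>{1..k}. f j - energy_measure g (?A j)) \<le> 0" by (simp add: sum_subtractf)
  moreover have "f i - energy_measure g (?A i) \<le> (\<Sum>j\<in>{1..k}. f j - energy_measure g (?A j))"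
    using le i by (intro member_le_sum) auto
  ultimately show ?thesis using le[OF i] by linarith
qed

section \<open>Comparison of two solutions\<close>

text \<open>
  An index that violates the conclusion and an index \<open>j\<close> that satisfies it would split the
  connected set \<open>D\<close> into two relatively closed sets, both nonempty because all \<open>f i\<close> are positive.
\<close>

lemma eccentricities_le:
  fixes x :: "'i \<Rightarrow> real^3"
  assumes I: "finite I" and D: "openin (top_of_set unit_sphere) D" "connected D"
    and g: "integrable sphere_measure g" and gpos: "\<And>m. m \<in> D \<Longrightarrow> g m > 0"
    and x: "\<And>i. i \<in> I \<Longrightarrow> x i \<noteq> 0"
    and domb: "\<And>i m. i \<in> I \<Longrightarrow> m \<in> D \<Longrightarrow> eb i > 1 \<and> eb i * (m \<bullet> sgn (x i)) > 1"
    and domt: "\<And>i m. i \<in> I \<Longrightarrow> m \<in> D \<Longrightarrow> et i > 1 \<and> et i * (m \<bullet> sgn (x i)) > 1"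
    and enb: "\<And>i. i \<in> I \<Longrightarrow> energy_measure g (cell D I x eb i) = f i"
    and ent: "\<And>i. i \<in> I \<Longrightarrow> energy_measure g (cell D I x et i) = f i"
    and fpos: "\<And>i. i \<in> I \<Longrightarrow> f i > 0"
    and total: "(\<Sum>i\<in>I. f i) = energy_measure g D"
    and j: "j \<in> I" "eb j \<le> et j"
  shows "\<forall>i\<in>I. eb i \<le> et i"
proof (rule ccontr)
  assume "\<not> (\<forall>i\<in>I. eb i \<le> et i)"
  then obtain i where i: "i \<in> I" "et i < eb i" by force
  define J where "J = {i\<in>I. et i < eb i}"
  define W W' where WW: "W = (\<Union>i\<in>J. cell D I x eb i)" "W' = (\<Union>i\<in>I - J. cell D I x et i)"
  have I0: "I \<noteq> {}" and JI: "J \<subseteq> I" using j by (auto simp: J_def)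
  have DS: "D \<subseteq> unit_sphere" using D by (auto simp: openin_open)
  have clb: "closedin (top_of_set D) (cell D I x eb i)" if "i \<in> I" for i
    using that domb by (intro closedin_cell)
  have clt: "closedin (top_of_set D) (cell D I x et i)" if "i \<in> I" for i
    using that domt by (intro closedin_cell)
  have fin: "finite J" "finite (I - J)" using I JI by (auto intro: finite_subset)
  have cl: "closedin (top_of_set D) W" "closedin (top_of_set D) W'"
    unfolding WW using fin JI clb clt by (auto intro!: closedin_Union)
  have sets: "W \<in> sets sphere_measure" "W' \<in> sets sphere_measure" "D \<in> sets sphere_measure"
    using cl sets_sphere_measure_closedin[OF D(1)] sets_sphere_measure_openin[OF D(1)] by auto
  have sub: "W \<subseteq> D" "W' \<subseteq> D" using cl by (auto simp: closedin_def)
  \<comment> \<open>From the first to the second solution the radii with index in \<open>J\<close> grow strictly and the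
    others do not grow.\<close>
  have disj: "W \<inter> W' = {}"
  proof (rule ccontr)
    assume "W \<inter> W' \<noteq> {}"
    then obtain m a b where a: "a \<in> J" "m \<in> cell D I x eb a"
      and b: "b \<in> I - J" "m \<in> cell D I x et b" by (auto simp: WW)
    have mD: "m \<in> D" "norm m = 1" using a DS by (auto simp: cell_def)
    have "hyp_radius (x a) (eb a) m < hyp_radius (x a) (et a) m"
      using a(1) x domt mD by (intro hyp_radius_strict_antimono) (auto simp: J_def)
    also have "\<dots> \<le> hyp_radius (x b) (et b) m" using a(1) JI b by (auto simp: cell_def)
    also have "\<dots> \<le> hyp_radius (x b) (eb b) m"
      using b(1) x domb mD by (intro hyp_radius_antimono) (auto simp: J_def)
    also have "\<dots> \<le> hyp_radius (x a) (eb a) m" using a b by (auto simp: cell_def)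
    finally show False by simp
  qed
  have "energy_measure g W = (\<Sum>i\<in>J. energy_measure g (cell D I x eb i))"
    unfolding WW using sets_sphere_measure_closedin[OF D(1) clb] UN_cell_eq[OF I I0] total enb
    by (intro energy_measure_UN_eq_sum[OF g I JI, where D = D]) (auto simp: gpos less_imp_le)
  also have "\<dots> = sum f J" using enb JI by (intro sum.cong) auto
  finally have W: "energy_measure g W = sum f J" .
  have "energy_measure g W' = (\<Sum>i\<in>I - J. energy_measure g (cell D I x et i))"
    unfolding WW using sets_sphere_measure_closedin[OF D(1) clt] UN_cell_eq[OF I I0] total ent
    by (intro energy_measure_UN_eq_sum[OF g I, where D = D]) (auto simp: gpos less_imp_le)
  also have "\<dots> = sum f (I - J)" using ent by (intro sum.cong) auto
  finally have W': "energy_measure g W' = sum f (I - J)" .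
  have "i \<in> J" "j \<in> I - J" using i j by (auto simp: J_def)
  moreover have "f l > 0" if "l \<in> J \<or> l \<in> I - J" for l using that JI fpos by blast
  ultimately have f0: "sum f J > 0" "sum f (I - J) > 0"
    using sum_pos[OF fin(1), of f] sum_pos[OF fin(2), of f] by blast+
  have "energy_measure g {} = 0" 
    by (simp add: energy_measure_def set_lebesgue_integral_def)
  then have ne: "W \<noteq> {}" "W' \<noteq> {}" using W W' f0 by auto
  \<comment> \<open>\<open>W\<close> and \<open>W'\<close> come from different solutions, but the prescribed energies are the same.\<close>
  have "D - (W \<union> W') = {}"
  proof (rule energy_measure_zero_openin_imp_empty[OF g])
    have "openin (top_of_set D) (D - (W \<union> W'))"
      using closedin_Un[OF cl] by (simp add: closedin_def)
    then show "openin (top_of_set unit_sphere) (D - (W \<union> W'))" using D(1) by (rule openin_trans)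
    have "energy_measure g ((W \<union> W') \<union> (D - (W \<union> W'))) =
        energy_measure g W + energy_measure g W' + energy_measure g (D - (W \<union> W'))"
      using sets disj by (simp add: energy_measure_Un_disjoint[OF g] del: Un_Diff_cancel)
    moreover have "(W \<union> W') \<union> (D - (W \<union> W')) = D" using sub by blast
    moreover have "sum f I = sum f J + sum f (I - J)"
      using I JI by (metis add.commute sum.subset_diff)
    ultimately show "energy_measure g (D - (W \<union> W')) = 0" using W W' total by simp
  qed (use gpos in auto)
  then have "D \<subseteq> W \<union> W'" by blast
  then show False using D(2) cl disj ne unfolding connected_closedin by blast
qed

theorem theorem4p1:
  fixes k :: nat
    and x :: "nat \<Rightarrow> real^3"
    and T :: "(real^3) set"
    and \<gamma> \<epsilon>' \<delta> :: real
    and g :: "real^3 \<Rightarrow> real"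
    and f :: "nat \<Rightarrow> real"
    and eb et :: "nat \<Rightarrow> real"
    and Rb Rt :: "(real^3) set"
  assumes "inj_on x {1..k}"
    and "\<forall>i\<in>{1..k}. x i \<noteq> 0"
    and "T = x ` {1..k}"
    and "hypothesis_H1 T"
    and "\<gamma> > 0"
    and "\<epsilon>' > 0"
    and "\<epsilon>' \<ge> eps0 T + \<gamma>"
    and "\<delta> = 1 / (eps0 T + \<gamma>)"
    and "integrable sphere_measure g"
    and "\<forall>m\<in>unit_sphere. g m \<ge> 0"
    and "\<forall>m\<in>aperture_dom T \<delta>. g m > 0"
    and "\<forall>m\<in>unit_sphere - aperture_dom T \<delta>. g m = 0"
    and "\<forall>i\<in>{1..k}. f i > 0"
    and "(\<Sum>i=1..k. f i) = energy_measure g (aperture_dom T \<delta>)"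
    and "\<forall>i\<in>{1..k}. eb i \<ge> \<epsilon>'" and "Rb = refractor k x eb"
    and "\<forall>i\<in>{1..k}. et i \<ge> \<epsilon>'" and "Rt = refractor k x et"
    and "Rb \<in> convex_refractors \<epsilon>' T"
    and "Rt \<in> convex_refractors \<epsilon>' T"
    and "\<forall>i\<in>{1..k}. energy T \<delta> g Rt {x i} = f i \<and> energy T \<delta> g Rb {x i} = f i"
  shows "((\<exists>j\<in>{1..k}. et j \<ge> eb j) \<longrightarrow> (\<forall>i\<in>{1..k}. et i \<ge> eb i)) \<and>
         ((\<exists>j\<in>{1..k}. et j = eb j) \<longrightarrow> (\<forall>i\<in>{1..k}. et i = eb i))"
proof -
  define D where "D = aperture_dom T \<delta>"
  have H: "T \<noteq> {}" "finite T" "0 \<notin> T" using assms(2,3,4) by (auto simp: hypothesis_H1_def)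
  have k: "k > 0" using H(1) assms(3) by (cases k) auto
  define d where "d = eps0 T + \<gamma>"
  have d: "d > 1" using eps0_ge_1[OF assms(4)] assms(5) by (simp add: d_def)
  have \<delta>: "\<delta> = 1 / d" "0 < \<delta>" "\<delta> < 1" using d assms(8) by (auto simp: d_def)
  have Deq: "D = {m \<in> unit_sphere. \<forall>x\<in>T. m \<bullet> sgn x > \<delta>}"
    unfolding D_def using H \<delta> by (intro aperture_dom_eq)
  have D: "openin (top_of_set unit_sphere) D" "connected D"
    by (simp add: D_def aperture_dom_def) (unfold Deq, rule connected_cap_Inter[OF \<delta>(2) H(1)])
  have dom: "norm m = 1 \<and> x j \<noteq> 0 \<and> e j > 1 \<and> e j * (m \<bullet> sgn (x j)) > 1"
    if "\<forall>i\<in>{1..k}. e i \<ge> \<epsilon>'" "j \<in> {1..k}" "m \<in> D" for e j m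
  proof -
    have e: "e j \<ge> d" using that assms(7) by (force simp: d_def)
    have "m \<bullet> sgn (x j) > \<delta>" using that assms(3) by (auto simp: Deq)
    then have m: "d * (m \<bullet> sgn (x j)) > 1" using d \<delta>(1) by (simp add: field_simps)
    moreover have "d * (m \<bullet> sgn (x j)) \<le> e j * (m \<bullet> sgn (x j))"
      using e \<open>m \<bullet> sgn (x j) > \<delta>\<close> \<delta>(2) by (intro mult_right_mono) auto
    ultimately show ?thesis using e d that assms(2) by (auto simp: Deq)
  qed
  have total: "(\<Sum>i\<in>{1..k}. f i) = energy_measure g D" using assms(14) by (simp add: D_def)
  have cell: "energy_measure g (cell D {1..k} x e i) = f i"
    if "\<forall>i\<in>{1..k}. e i \<ge> \<epsilon>'" "\<forall>i\<in>{1..k}. energy T \<delta> g (refractor k x e) {x i} = f i"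
      "i \<in> {1..k}" for e i
    using assms(9,10,13) k that total dom[OF that(1)]
    by (intro energy_measure_cell[OF _ _ D_def]) auto
  have compare: "\<forall>i\<in>{1..k}. e i \<le> e' i"
    if "\<forall>i\<in>{1..k}. e i \<ge> \<epsilon>'" "\<forall>i\<in>{1..k}. energy T \<delta> g (refractor k x e) {x i} = f i"
      "\<forall>i\<in>{1..k}. e' i \<ge> \<epsilon>'" "\<forall>i\<in>{1..k}. energy T \<delta> g (refractor k x e') {x i} = f i"
      "j \<in> {1..k}" "e j \<le> e' j" for e e' j
  proof (rule eccentricities_le[OF _ D assms(9)])
    show "g m > 0" if "m \<in> D" for m using that assms(11) by (simp add: D_def)
    show "e i > 1 \<and> e i * (m \<bullet> sgn (x i)) > 1" "e' i > 1 \<and> e' i * (m \<bullet> sgn (x i)) > 1"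
      if "i \<in> {1..k}" "m \<in> D" for i m
      using dom[OF \<open>\<forall>i\<in>{1..k}. e i \<ge> \<epsilon>'\<close> that] dom[OF \<open>\<forall>i\<in>{1..k}. e' i \<ge> \<epsilon>'\<close> that] by auto
    show "energy_measure g (cell D {1..k} x e i) = f i" if "i \<in> {1..k}" for i
      using \<open>\<forall>i\<in>{1..k}. e i \<ge> \<epsilon>'\<close> \<open>\<forall>i\<in>{1..k}. energy T \<delta> g (refractor k x e) {x i} = f i\<close> that
      by (rule cell)
    show "energy_measure g (cell D {1..k} x e' i) = f i" if "i \<in> {1..k}" for i
      using \<open>\<forall>i\<in>{1..k}. e' i \<ge> \<epsilon>'\<close> \<open>\<forall>i\<in>{1..k}. energy T \<delta> g (refractor k x e') {x i} = f i\<close> that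
      by (rule cell)
  qed (use assms(2,13) total that(5,6) in auto)
  have en: "\<forall>i\<in>{1..k}. energy T \<delta> g (refractor k x eb) {x i} = f i"
    "\<forall>i\<in>{1..k}. energy T \<delta> g (refractor k x et) {x i} = f i"
    using assms(16,18,21) by auto
  note le = compare[OF assms(15) en(1) assms(17) en(2)]
    and ge = compare[OF assms(17) en(2) assms(15) en(1)]
  show ?thesis
  proof (intro conjI impI)
    assume "\<exists>j\<in>{1..k}. et j \<ge> eb j"
    then show "\<forall>i\<in>{1..k}. et i \<ge> eb i" using le by blast
  next
    assume "\<exists>j\<in>{1..k}. et j = eb j"
    then obtain j where "j \<in> {1..k}" "et j = eb j" by blast
    then show "\<forall>i\<in>{1..k}. et i = eb i" using le[of j] ge[of j] by (auto intro: antisym)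
  qed
qed

end
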